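(* Let $J\subseteq I$ be ideals in a commutative Noetherian ring $R$, and let $f:R\rightarrow S$ be a homomorphism of commutative rings. Denote $I^e:=IS$ and $J^e:=JS$. Then the following statements hold. (i) If $J$ is a demotion of $I$, then $J^k$ is a demotion of $I^k$ for all $k\geq 1$. (ii) If $S$ is flat over $R$ and $J$ is a demotion of $I$ in $R$, then $J^e$ is a demotion of $I^e$ in $S$. (iii) If $S$ is faithfully flat over $R$ and $J^e$ is a demotion of $I^e$ in $S$, then $J$ is a demotion of $I$ in $R$.
   Context: For ideals $J\subseteq I$ in a commutative Noetherian ring $R$, $J$ is a demotion of $I$ if $I^rJ^s=I^{r+s}\cap J^s$ for all integers $r,s\geq 0$ (with $I^0=J^0=R$); the same equalities define a demotion for ideals of $S$. $IS$ denotes the ideal $f(I)S$ of $S$ generated by $f(I)$. *)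

theory Defs
  imports
    "HOL-Algebra.Module"
    "HOL-Algebra.Ideal_Product"
    "HOL-Algebra.Ring_Divisibility"
    "HOL-Algebra.Free_Abelian_Groups"
begin

section \<open>Demotions\<close>

text \<open>Powers are taken in the multiplicative monoid of ideals \<^term>\<open>ideals_set R\<close>, whose
  product is the ideal product and whose unit is \<^term>\<open>carrier R\<close>; so the zeroth power is the
  whole ring.\<close>

abbreviation ideal_pow :: "('a, 'm) ring_scheme \<Rightarrow> 'a set \<Rightarrow> nat \<Rightarrow> 'a set"
  where "ideal_pow R I n \<equiv> I [^]\<^bsub>ideals_set R\<^esub> n"

definition demotion :: "('a, 'm) ring_scheme \<Rightarrow> 'a set \<Rightarrow> 'a set \<Rightarrow> bool"
  where "demotion R J I \<longleftrightarrow>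
    ideal I R \<and> ideal J R \<and> J \<subseteq> I \<and>
    (\<forall>r s. ideal_prod R (ideal_pow R I r) (ideal_pow R J s)
             = ideal_pow R I (r + s) \<inter> ideal_pow R J s)"

definition ideal_ext :: "('b, 'n) ring_scheme \<Rightarrow> ('a \<Rightarrow> 'b) \<Rightarrow> 'a set \<Rightarrow> 'b set"
  where "ideal_ext S f I = Idl\<^bsub>S\<^esub> (f ` I)"


section \<open>Tensor products and flatness\<close>

definition restrict_scalars :: "('a \<Rightarrow> 'b) \<Rightarrow> ('b, 'n) ring_scheme \<Rightarrow> ('a, 'b) module"
  where "restrict_scalars f S =
    \<lparr> carrier = carrier S, monoid.mult = monoid.mult S, monoid.one = monoid.one S, ring.zero = ring.zero S, ring.add = ring.add S,
      smult = (\<lambda>a s. f a \<otimes>\<^bsub>S\<^esub> s) \<rparr>"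

definition linear_maps ::
    "('a, 'm) ring_scheme \<Rightarrow> ('a, 'c, 'p) module_scheme \<Rightarrow> ('a, 'd, 'q) module_scheme \<Rightarrow> ('c \<Rightarrow> 'd) set"
  where "linear_maps R M N =
    {\<phi> \<in> hom (add_monoid M) (add_monoid N).
       \<forall>a \<in> carrier R. \<forall>x \<in> carrier M. \<phi> (a \<odot>\<^bsub>M\<^esub> x) = a \<odot>\<^bsub>N\<^esub> \<phi> x}"

text \<open>The tensor product over \<^term>\<open>R\<close> is the free abelian group on pairs modulo the bilinearity
  relations. Only its underlying abelian group is needed, since exactness of a sequence of modules
  is exactness of the sequence of abelian groups.\<close>

definition tensor_relators ::
    "('a, 'm) ring_scheme \<Rightarrow> ('a, 'c, 'p) module_scheme \<Rightarrow> ('a, 'd, 'q) module_scheme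
      \<Rightarrow> (('c \<times> 'd) \<Rightarrow>\<^sub>0 int) set"
  where "tensor_relators R M N =
    {frag_of (x \<oplus>\<^bsub>M\<^esub> x', y) - frag_of (x, y) - frag_of (x', y) | x x' y.
       x \<in> carrier M \<and> x' \<in> carrier M \<and> y \<in> carrier N} \<union>
    {frag_of (x, y \<oplus>\<^bsub>N\<^esub> y') - frag_of (x, y) - frag_of (x, y') | x y y'.
       x \<in> carrier M \<and> y \<in> carrier N \<and> y' \<in> carrier N} \<union>
    {frag_of (a \<odot>\<^bsub>M\<^esub> x, y) - frag_of (x, a \<odot>\<^bsub>N\<^esub> y) | a x y.
       a \<in> carrier R \<and> x \<in> carrier M \<and> y \<in> carrier N}"

abbreviation tensor_free ::
    "('a, 'c, 'p) module_scheme \<Rightarrow> ('a, 'd, 'q) module_scheme \<Rightarrow> (('c \<times> 'd) \<Rightarrow>\<^sub>0 int) monoid"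
  where "tensor_free M N \<equiv> free_Abelian_group (carrier M \<times> carrier N)"

definition tensor_null ::
    "('a, 'm) ring_scheme \<Rightarrow> ('a, 'c, 'p) module_scheme \<Rightarrow> ('a, 'd, 'q) module_scheme
      \<Rightarrow> (('c \<times> 'd) \<Rightarrow>\<^sub>0 int) set"
  where "tensor_null R M N = generate (tensor_free M N) (tensor_relators R M N)"

definition tensor_prod ::
    "('a, 'm) ring_scheme \<Rightarrow> ('a, 'c, 'p) module_scheme \<Rightarrow> ('a, 'd, 'q) module_scheme
      \<Rightarrow> (('c \<times> 'd) \<Rightarrow>\<^sub>0 int) set monoid"
  where "tensor_prod R M N = tensor_free M N Mod tensor_null R M N"

text \<open>The map induced by tensoring \<open>\<phi> : N \<rightarrow> N'\<close> with the identity of \<open>M\<close>. A coset \<open>X\<close> is sent to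
  the coset of the image of any of its representatives; the union is over equal sets, see
  \<open>tensor_map_coset\<close> below.\<close>

definition tensor_map ::
    "('a, 'm) ring_scheme \<Rightarrow> ('a, 'd, 'q) module_scheme \<Rightarrow> ('a, 'e, 'r) module_scheme \<Rightarrow> ('c \<Rightarrow> 'd)
      \<Rightarrow> (('c \<times> 'e) \<Rightarrow>\<^sub>0 int) set \<Rightarrow> (('d \<times> 'e) \<Rightarrow>\<^sub>0 int) set"
  where "tensor_map R N' M \<phi> X =
    (\<Union>u\<in>X. tensor_null R N' M #>\<^bsub>tensor_free N' M\<^esub> frag_extend (\<lambda>(x, y). frag_of (\<phi> x, y)) u)"

text \<open>Exactness of \<open>G1 \<rightarrow> G2 \<rightarrow> G3\<close> at the middle term, for homomorphisms \<open>g\<close> and \<open>h\<close>. The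
  library's \<open>exact_seq\<close> needs plain monoid records, which \<^term>\<open>add_monoid M\<close> is not.\<close>

definition exact_at ::
    "('c, 'p) monoid_scheme \<Rightarrow> ('c \<Rightarrow> 'd) \<Rightarrow> ('d, 'q) monoid_scheme \<Rightarrow> ('d \<Rightarrow> 'e)
      \<Rightarrow> ('e, 'r) monoid_scheme \<Rightarrow> bool"
  where "exact_at G1 g G2 h G3 \<longleftrightarrow> g ` carrier G1 = kernel G2 G3 h"

text \<open>A module \<open>M\<close> is flat if tensoring with it preserves exactness of sequences
  \<open>N1 \<rightarrow> N2 \<rightarrow> N3\<close>, and faithfully flat if it preserves and reflects exactness. HOL cannot
  quantify over the carrier types of the \<open>Ni\<close>, so they are fixed to be
  \<^typ>\<open>(nat \<Rightarrow> 'a) set\<close>. Up to isomorphism this includes every finitely generated module over a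
  ring with elements in \<^typ>\<open>'a\<close> (see \<open>finitely_generated_in_universe\<close> below), in particular all
  finitely generated ideals and all cyclic modules, and this is enough to test flatness
  and faithful flatness; so the notions coincide with the usual ones.\<close>

definition flat_module :: "('a, 'm) ring_scheme \<Rightarrow> ('a, 'b, 'p) module_scheme \<Rightarrow> bool"
  where "flat_module R M \<longleftrightarrow> module R M \<and>
    (\<forall>(N1 :: ('a, (nat \<Rightarrow> 'a) set) module) (N2 :: ('a, (nat \<Rightarrow> 'a) set) module)
      (N3 :: ('a, (nat \<Rightarrow> 'a) set) module) \<phi> \<psi>.
      module R N1 \<longrightarrow> module R N2 \<longrightarrow> module R N3 \<longrightarrow>
      \<phi> \<in> linear_maps R N1 N2 \<longrightarrow> \<psi> \<in> linear_maps R N2 N3 \<longrightarrow>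
      exact_at (add_monoid N1) \<phi> (add_monoid N2) \<psi> (add_monoid N3) \<longrightarrow>
      exact_at (tensor_prod R N1 M) (tensor_map R N2 M \<phi>) (tensor_prod R N2 M)
                 (tensor_map R N3 M \<psi>) (tensor_prod R N3 M))"

definition faithfully_flat_module :: "('a, 'm) ring_scheme \<Rightarrow> ('a, 'b, 'p) module_scheme \<Rightarrow> bool"
  where "faithfully_flat_module R M \<longleftrightarrow> module R M \<and>
    (\<forall>(N1 :: ('a, (nat \<Rightarrow> 'a) set) module) (N2 :: ('a, (nat \<Rightarrow> 'a) set) module)
      (N3 :: ('a, (nat \<Rightarrow> 'a) set) module) \<phi> \<psi>.
      module R N1 \<longrightarrow> module R N2 \<longrightarrow> module R N3 \<longrightarrow>
      \<phi> \<in> linear_maps R N1 N2 \<longrightarrow> \<psi> \<in> linear_maps R N2 N3 \<longrightarrow>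
      (exact_at (add_monoid N1) \<phi> (add_monoid N2) \<psi> (add_monoid N3) \<longleftrightarrow>
       exact_at (tensor_prod R N1 M) (tensor_map R N2 M \<phi>) (tensor_prod R N2 M)
                  (tensor_map R N3 M \<psi>) (tensor_prod R N3 M)))"


section \<open>The definitions are well behaved\<close>

lemma faithfully_flat_imp_flat: "faithfully_flat_module R M \<Longrightarrow> flat_module R M"
  unfolding faithfully_flat_module_def flat_module_def by blast

lemma module_restrict_scalars:
  assumes "cring R" "cring S" "f \<in> ring_hom R S"
  shows "module R (restrict_scalars f S)"
proof -
  interpret R: cring R by fact
  interpret S: cring S by fact
  note h = ring_hom_closed[OF assms(3)] ring_hom_mult[OF assms(3)] ring_hom_add[OF assms(3)]
    ring_hom_one[OF assms(3)]
  have "abelian_group (restrict_scalars f S)"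
    by (rule abelian_groupI)
      (auto simp: restrict_scalars_def S.a_ac intro: S.l_neg bexI[of _ "\<ominus>\<^bsub>S\<^esub> _"])
  then show ?thesis
    by (intro moduleI assms(1)) (auto simp: restrict_scalars_def h S.l_distr S.r_distr S.m_assoc)
qed

lemma diff_in_free_Abelian_group:
  assumes "u \<in> carrier (free_Abelian_group A)" "v \<in> carrier (free_Abelian_group A)"
  shows "u - v \<in> carrier (free_Abelian_group A)"
  using assms keys_diff[of u v] by auto

lemma tensor_relators_closed:
  assumes "module R M" "module R N"
  shows "tensor_relators R M N \<subseteq> carrier (tensor_free M N)"
proof -
  interpret M: module R M by fact
  interpret N: module R N by fact
  show ?thesis
    unfolding tensor_relators_def
    by (auto simp del: carrier_free_Abelian_group_iff intro!: diff_in_free_Abelian_group)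
qed

lemma tensor_null_normal:
  assumes "module R M" "module R N"
  shows "tensor_null R M N \<lhd> tensor_free M N"
  unfolding tensor_null_def
  using tensor_relators_closed[OF assms]
  by (meson abelian_free_Abelian_group comm_group.subgroup_imp_normal group.generate_is_subgroup
      group_free_Abelian_group)

lemma comm_group_tensor_prod:
  assumes "module R M" "module R N"
  shows "comm_group (tensor_prod R M N)"
  unfolding tensor_prod_def
  by (rule comm_group.abelian_FactGroup[OF abelian_free_Abelian_group
        normal_imp_subgroup[OF tensor_null_normal[OF assms]]])

abbreviation tensor_lift :: "('c \<Rightarrow> 'd) \<Rightarrow> (('c \<times> 'e) \<Rightarrow>\<^sub>0 int) \<Rightarrow> (('d \<times> 'e) \<Rightarrow>\<^sub>0 int)"
  where "tensor_lift \<phi> \<equiv> frag_extend (\<lambda>(x, y). frag_of (\<phi> x, y))"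

lemma tensor_lift_hom:
  assumes "\<phi> \<in> linear_maps R N N'"
  shows "tensor_lift \<phi> \<in> hom (tensor_free N M) (tensor_free N' M)"
proof (rule homI)
  fix u assume u: "u \<in> carrier (tensor_free N M)"
  have "\<phi> x \<in> carrier N'" if "x \<in> carrier N" for x
    using assms that by (auto simp: linear_maps_def hom_def)
  then show "tensor_lift \<phi> u \<in> carrier (tensor_free N' M)"
    using u keys_frag_extend[of "\<lambda>(x, y). frag_of (\<phi> x, y)" u]
    by fastforce
qed (simp add: frag_extend_add)

lemma tensor_lift_null:
  assumes N: "module R N" and N': "module R N'" and M: "module R M"
    and \<phi>: "\<phi> \<in> linear_maps R N N'" and u: "u \<in> tensor_null R N M"
  shows "tensor_lift \<phi> u \<in> tensor_null R N' M"
proof -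
  have \<phi>c: "\<phi> x \<in> carrier N'" if "x \<in> carrier N" for x
    using \<phi> that by (auto simp: linear_maps_def hom_def)
  have \<phi>a: "\<phi> (x \<oplus>\<^bsub>N\<^esub> y) = \<phi> x \<oplus>\<^bsub>N'\<^esub> \<phi> y" if "x \<in> carrier N" "y \<in> carrier N" for x y
    using \<phi> that by (auto simp: linear_maps_def hom_def)
  have \<phi>s: "\<phi> (a \<odot>\<^bsub>N\<^esub> x) = a \<odot>\<^bsub>N'\<^esub> \<phi> x" if "a \<in> carrier R" "x \<in> carrier N" for a x
    using \<phi> that by (auto simp: linear_maps_def)
  have rel: "tensor_lift \<phi> h \<in> tensor_relators R N' M" if "h \<in> tensor_relators R N M" for h
    using that unfolding tensor_relators_def Un_iff mem_Collect_eq
  proof (elim disjE exE conjE, goal_cases)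
    case (1 x x' y)
    then show ?case
      by (intro disjI1 exI[of _ "\<phi> x"] exI[of _ "\<phi> x'"] exI[of _ y])
        (simp add: frag_extend_diff \<phi>c \<phi>a)
  next
    case (2 x y y')
    then show ?case
      by (intro disjI1 disjI2 exI[of _ "\<phi> x"] exI[of _ y] exI[of _ y'])
        (simp add: frag_extend_diff \<phi>c)
  next
    case (3 a x y)
    then show ?case
      by (intro disjI2 exI[of _ a] exI[of _ "\<phi> x"] exI[of _ y])
        (simp add: frag_extend_diff \<phi>c \<phi>s)
  qed
  show ?thesis
    using u unfolding tensor_null_def
  proof (induction rule: generate.induct)
    case one
    then show ?case by (metis generate.one frag_extend_0 one_free_Abelian_group)
  next
    case (incl h)
    then show ?case by (simp add: generate.incl rel)
  next
    case (inv h)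
    have "Poly_Mapping.keys h \<subseteq> carrier N \<times> carrier M"
      by (rule subsetD[OF tensor_relators_closed[OF N M] inv, unfolded carrier_free_Abelian_group_iff])
    moreover have "Poly_Mapping.keys (tensor_lift \<phi> h) \<subseteq> carrier N' \<times> carrier M"
      by (rule subsetD[OF tensor_relators_closed[OF N' M] rel[OF inv],
            unfolded carrier_free_Abelian_group_iff])
    ultimately show ?case
      using generate.inv[OF rel[OF inv], of "tensor_free N' M"]
      by (simp add: frag_extend_minus)
  next
    case (eng h1 h2)
    then show ?case
      using generate.eng[OF eng.IH] by (simp add: frag_extend_add)
  qed
qed

lemma tensor_map_coset:
  assumes N: "module R N" and N': "module R N'" and M: "module R M"
    and \<phi>: "\<phi> \<in> linear_maps R N N'" and u: "u \<in> carrier (tensor_free N M)"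
  shows "tensor_map R N' M \<phi> (tensor_null R N M #>\<^bsub>tensor_free N M\<^esub> u)
           = tensor_null R N' M #>\<^bsub>tensor_free N' M\<^esub> tensor_lift \<phi> u"
proof -
  interpret F': comm_group "tensor_free N' M" by (rule abelian_free_Abelian_group)
  have nul: "0 \<in> tensor_null R N M"
    unfolding tensor_null_def by (metis generate.one one_free_Abelian_group)
  have sub: "subgroup (tensor_null R N' M) (tensor_free N' M)"
    by (simp add: N' M tensor_null_normal normal_imp_subgroup)
  have "tensor_null R N' M #>\<^bsub>tensor_free N' M\<^esub> tensor_lift \<phi> (v + u)
          = tensor_null R N' M #>\<^bsub>tensor_free N' M\<^esub> tensor_lift \<phi> u"
    if "v \<in> tensor_null R N M" for v
  proof -
    have v: "tensor_lift \<phi> v \<in> tensor_null R N' M"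
      by (rule tensor_lift_null[OF N N' M \<phi> that])
    then have vc: "tensor_lift \<phi> v \<in> carrier (tensor_free N' M)"
      by (rule subgroup.mem_carrier[OF sub])
    have uc: "tensor_lift \<phi> u \<in> carrier (tensor_free N' M)"
      using hom_in_carrier[OF tensor_lift_hom[OF \<phi>] u] .
    show ?thesis
      using F'.coset_mult_assoc[OF subgroup.subset[OF sub] vc uc]
        F'.coset_join2[OF vc sub v]
      by (simp add: frag_extend_add)
  qed
  moreover have "0 + u \<in> tensor_null R N M #>\<^bsub>tensor_free N M\<^esub> u"
    using nul by (force simp: r_coset_def)
  ultimately show ?thesis
    using nul unfolding tensor_map_def by (auto simp: r_coset_def[of "tensor_free N M"])
qed

lemma tensor_map_hom:
  assumes N: "module R N" and N': "module R N'" and M: "module R M"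
    and \<phi>: "\<phi> \<in> linear_maps R N N'"
  shows "tensor_map R N' M \<phi> \<in> hom (tensor_prod R N M) (tensor_prod R N' M)"
proof -
  interpret H: normal "tensor_null R N M" "tensor_free N M" by (rule tensor_null_normal[OF N M])
  interpret H': normal "tensor_null R N' M" "tensor_free N' M" by (rule tensor_null_normal[OF N' M])
  note lc = hom_in_carrier[OF tensor_lift_hom[OF \<phi>]]
  show ?thesis
  proof (rule homI)
    fix X assume "X \<in> carrier (tensor_prod R N M)"
    then obtain u where u: "u \<in> carrier (tensor_free N M)"
      and X: "X = tensor_null R N M #>\<^bsub>tensor_free N M\<^esub> u"
      by (auto simp: tensor_prod_def FactGroup_def RCOSETS_def)
    show "tensor_map R N' M \<phi> X \<in> carrier (tensor_prod R N' M)"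
      using lc[OF u] unfolding X tensor_map_coset[OF N N' M \<phi> u]
      by (auto simp: tensor_prod_def FactGroup_def RCOSETS_def)
  next
    fix X Y assume "X \<in> carrier (tensor_prod R N M)" "Y \<in> carrier (tensor_prod R N M)"
    then obtain u v where u: "u \<in> carrier (tensor_free N M)"
      and X: "X = tensor_null R N M #>\<^bsub>tensor_free N M\<^esub> u"
      and v: "v \<in> carrier (tensor_free N M)"
      and Y: "Y = tensor_null R N M #>\<^bsub>tensor_free N M\<^esub> v"
      by (auto simp: tensor_prod_def FactGroup_def RCOSETS_def)
    have uv: "u + v \<in> carrier (tensor_free N M)"
      using H.m_closed[OF u v] by simp
    show "tensor_map R N' M \<phi> (X \<otimes>\<^bsub>tensor_prod R N M\<^esub> Y)
        = tensor_map R N' M \<phi> X \<otimes>\<^bsub>tensor_prod R N' M\<^esub> tensor_map R N' M \<phi> Y"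
      using H.rcos_sum[OF u v] H'.rcos_sum[OF lc[OF u] lc[OF v]]
        tensor_map_coset[OF N N' M \<phi> uv]
      by (simp add: X Y tensor_prod_def FactGroup_def tensor_map_coset[OF N N' M \<phi> u]
          tensor_map_coset[OF N N' M \<phi> v] frag_extend_add)
  qed
qed

lemma finitely_generated_in_universe:
  fixes R :: "('a, 'm) ring_scheme" and N :: "('a, 'c) module" and x :: "nat \<Rightarrow> 'c"
  assumes "module R N" and x: "\<And>i. i < k \<Longrightarrow> x i \<in> carrier N"
    and gen: "\<And>n. n \<in> carrier N \<Longrightarrow>
      \<exists>c. (\<forall>i. c i \<in> carrier R) \<and> n = (\<Oplus>\<^bsub>N\<^esub>i\<in>{..<k}. c i \<odot>\<^bsub>N\<^esub> x i)"
  shows "\<exists>(N' :: ('a, (nat \<Rightarrow> 'a) set) module) \<phi>.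
    module R N' \<and> \<phi> \<in> linear_maps R N N' \<and> bij_betw \<phi> (carrier N) (carrier N')"
proof -
  interpret module R N by fact
  define \<phi> where "\<phi> n = {c. (\<forall>i. c i \<in> carrier R) \<and> n = (\<Oplus>\<^bsub>N\<^esub>i\<in>{..<k}. c i \<odot>\<^bsub>N\<^esub> x i)}" for n
  define \<psi> where "\<psi> = inv_into (carrier N) \<phi>"
  have inj: "inj_on \<phi> (carrier N)"
  proof (rule inj_onI)
    fix n n' assume n: "n \<in> carrier N" "n' \<in> carrier N" "\<phi> n = \<phi> n'"
    from gen[OF n(1)] obtain c where "c \<in> \<phi> n" by (auto simp: \<phi>_def)
    with n(3) have "c \<in> \<phi> n" "c \<in> \<phi> n'" by auto
    then show "n = n'" by (simp add: \<phi>_def)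
  qed
  have \<psi>\<phi>: "\<psi> (\<phi> n) = n" if "n \<in> carrier N" for n
    using inj that by (simp add: \<psi>_def)
  define N' :: "('a, (nat \<Rightarrow> 'a) set) module" where
    "N' = \<lparr> carrier = \<phi> ` carrier N, monoid.mult = undefined, monoid.one = undefined, ring.zero = \<phi> \<zero>\<^bsub>N\<^esub>,
      ring.add = (\<lambda>X Y. \<phi> (\<psi> X \<oplus>\<^bsub>N\<^esub> \<psi> Y)), smult = (\<lambda>a X. \<phi> (a \<odot>\<^bsub>N\<^esub> \<psi> X)) \<rparr>"
  have inv: "\<exists>y\<in>carrier N. \<phi> (n \<oplus>\<^bsub>N\<^esub> y) = \<phi> \<zero>\<^bsub>N\<^esub>" if "n \<in> carrier N" for n
    using that M.r_neg M.a_inv_closed by metis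
  have "abelian_group N'"
    by (rule abelian_groupI) (auto simp: N'_def \<psi>\<phi> M.a_ac inv)
  then have "module R N'"
    by (intro moduleI)
      (auto simp: N'_def \<psi>\<phi> smult_l_distr smult_r_distr smult_assoc1 intro: R.is_cring)
  moreover have "\<phi> \<in> linear_maps R N N'"
    by (auto simp: linear_maps_def hom_def N'_def \<psi>\<phi>)
  moreover have "bij_betw \<phi> (carrier N) (carrier N')"
    using inj by (simp add: bij_betw_def N'_def)
  ultimately show ?thesis by blast
qed

end

theory Submission
  imports Defs
begin

text \<open>Write \<open>AS\<close> for the extension of an ideal \<open>A\<close> of \<open>R\<close>. Part (i) is arithmetic of exponents:
  the condition for \<open>J\<^sup>k \<subseteq> I\<^sup>k\<close> at \<open>(r, s)\<close> is the condition for \<open>J \<subseteq> I\<close> at \<open>(kr, ks)\<close>.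

  Extension of ideals always commutes with products and powers. So parts (ii) and (iii) come down
  to two facts: over a flat algebra extension commutes with binary intersections, and over a
  faithfully flat algebra an ideal is determined by its extension. For (ii), extend the equality
  \<open>I\<^sup>rJ\<^sup>s = I\<^sup>r\<^sup>+\<^sup>s \<inter> J\<^sup>s\<close>; for (iii), observe that its two sides have the same extension.

  Both facts are read off from sequences \<open>L' \<rightarrow> L \<rightarrow> R/K\<close> with \<open>L' \<subseteq> L\<close> and \<open>K\<close> ideals. Such a
  sequence is exact iff \<open>L' = L \<inter> K\<close> (\<open>subquotient_exact_iff\<close>). After tensoring with \<open>S\<close>, three
  facts suffice, and no tensor product other than \<open>R/K \<otimes> S\<close> has to be computed:
  \<^item> in \<open>R/K \<otimes> S\<close> the tensor \<open>1 \<otimes> x\<close> vanishes iff \<open>x \<in> KS\<close>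
    (\<open>pt_one_null\<close>, \<open>pt_one_nullD\<close>);
  \<^item> if \<open>x \<in> LS\<close>, then \<open>1 \<otimes> x \<in> R \<otimes> S\<close> is the image of an element of \<open>L \<otimes> S\<close>
    (\<open>ideal_ext_obtain_tensor\<close>);
  \<^item> conversely the image in \<open>R \<otimes> S\<close> of an element of \<open>L \<otimes> S\<close> is \<open>1 \<otimes> x\<close> for some \<open>x \<in> LS\<close>
    (\<open>tensor_obtain_ideal_ext\<close>).

  For intersections, take \<open>A \<inter> B \<rightarrow> B \<rightarrow> R/A\<close>. If \<open>x \<in> AS \<inter> BS\<close>, lift \<open>1 \<otimes> x\<close> to \<open>B \<otimes> S\<close>; the lift
  dies in \<open>R/A \<otimes> S\<close>, so by exactness it comes from \<open>(A \<inter> B) \<otimes> S\<close>, whence \<open>x \<in> (A \<inter> B)S\<close>. For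
  descent, take \<open>A \<rightarrow> R \<rightarrow> R/B\<close>: if \<open>AS = BS\<close>, then the tensored sequence is exact, because the
  kernel at \<open>R \<otimes> S\<close> is \<open>BS\<close> and the image is \<open>AS\<close>. Faithful flatness makes the sequence itself
  exact, that is \<open>A = B\<close>.\<close>


section \<open>Powers of ideals\<close>

lemma (in cring) ideal_pow_is_ideal:
  assumes "ideal I R"
  shows "ideal (ideal_pow R I n) R"
  using monoid.nat_pow_closed[OF comm_monoid.axioms(1)[OF ideals_set_is_comm_monoid], of I n] assms
  by (simp add: ideals_set_def)

lemma (in cring) ideal_pow_pow:
  assumes "ideal I R"
  shows "ideal_pow R (ideal_pow R I m) n = ideal_pow R I (m * n)"
  using monoid.nat_pow_pow[OF comm_monoid.axioms(1)[OF ideals_set_is_comm_monoid], of I m n] assms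
  by (simp add: ideals_set_def)

lemma ideal_pow_0: "ideal_pow R I 0 = carrier R"
  by (simp add: nat_pow_def ideals_set_def)

lemma ideal_pow_Suc: "ideal_pow R I (Suc n) = ideal_prod R (ideal_pow R I n) I"
  by (simp add: nat_pow_def ideals_set_def)

lemma ideal_prod_mono:
  assumes "A \<subseteq> A'" "B \<subseteq> B'"
  shows "ideal_prod R A B \<subseteq> ideal_prod R A' B'"
proof
  fix x assume "x \<in> ideal_prod R A B"
  then show "x \<in> ideal_prod R A' B'"
    by induction (use assms in \<open>auto intro: ideal_prod.intros\<close>)
qed

lemma ideal_pow_mono:
  assumes "J \<subseteq> I"
  shows "ideal_pow R J n \<subseteq> ideal_pow R I n"
proof (induction n)
  case (Suc n)
  then show ?case
    unfolding ideal_pow_Suc using assms by (rule ideal_prod_mono)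
qed (simp add: ideal_pow_0)

lemma (in cring) demotion_pow:
  assumes "demotion R J I"
  shows "demotion R (ideal_pow R J k) (ideal_pow R I k)"
proof -
  have I: "ideal I R" and J: "ideal J R" and "J \<subseteq> I"
    and eq: "\<And>r s. ideal_prod R (ideal_pow R I r) (ideal_pow R J s)
               = ideal_pow R I (r + s) \<inter> ideal_pow R J s"
    using assms by (auto simp: demotion_def)
  have "ideal_prod R (ideal_pow R (ideal_pow R I k) r) (ideal_pow R (ideal_pow R J k) s)
          = ideal_pow R (ideal_pow R I k) (r + s) \<inter> ideal_pow R (ideal_pow R J k) s" for r s
    using eq[of "k * r" "k * s"] by (simp add: ideal_pow_pow I J distrib_left)
  then show ?thesis
    by (simp add: demotion_def ideal_pow_is_ideal I J ideal_pow_mono \<open>J \<subseteq> I\<close>)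
qed


section \<open>Extension of ideals\<close>

context ring_hom_cring
begin

lemma ideal_ext_is_ideal:
  assumes "ideal A R"
  shows "ideal (ideal_ext S h A) S"
  unfolding ideal_ext_def using assms
  by (intro S.genideal_ideal) (auto dest: ideal.Icarr)

lemma ideal_ext_incl:
  assumes "ideal A R" "a \<in> A"
  shows "h a \<in> ideal_ext S h A"
  unfolding ideal_ext_def using S.genideal_self[of "h ` A"] assms
  by (auto dest: ideal.Icarr)

lemma ideal_ext_mono:
  assumes "A \<subseteq> B"
  shows "ideal_ext S h A \<subseteq> ideal_ext S h B"
  using assms unfolding ideal_ext_def genideal_def by blast

text \<open>The inductive description of the extension as the set of sums of terms \<open>h a \<cdot> s\<close>; it
  provides the induction principle below.\<close>

lemma ideal_ext_eq_sums:
  assumes A: "ideal A R"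
  shows "ideal_ext S h A = ideal_prod S (h ` A) (carrier S)"
proof
  interpret A: ideal A R by fact
  let ?P = "ideal_prod S (h ` A) (carrier S)"
  have car: "x \<in> carrier S" if "x \<in> ?P" for x
    using that by induction (auto dest: A.Icarr)
  have smult: "s \<otimes>\<^bsub>S\<^esub> x \<in> ?P" if "x \<in> ?P" "s \<in> carrier S" for x s
    using that(1)
  proof induction
    case (prod i j)
    then show ?case
      using ideal_prod.prod[of i "h ` A" "s \<otimes>\<^bsub>S\<^esub> j" "carrier S" S] that(2)
      by (auto simp: S.m_lcomm dest: A.Icarr)
  next
    case (sum x y)
    then show ?case
      using that(2) by (simp add: S.r_distr car ideal_prod.sum)
  qed
  have "ideal ?P S"
  proof (rule idealI)
    show "subgroup ?P (add_monoid S)"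
    proof (rule S.add.subgroupI)
      show "?P \<noteq> {}"
        using ideal_prod.prod[OF imageI[OF A.zero_closed] S.zero_closed] by blast
      show "\<ominus>\<^bsub>S\<^esub> x \<in> ?P" if "x \<in> ?P" for x
        using smult[OF that, of "\<ominus>\<^bsub>S\<^esub> \<one>\<^bsub>S\<^esub>"] car[OF that]
        by (simp add: S.l_minus)
    qed (use car ideal_prod.sum in \<open>auto\<close>)
    show "x \<otimes>\<^bsub>S\<^esub> s \<in> ?P" if "x \<in> ?P" "s \<in> carrier S" for x s
      using smult[OF that] car[OF that(1)] that(2) by (simp add: S.m_comm)
  qed (use smult in \<open>auto intro: S.ring_axioms\<close>)
  moreover have "h ` A \<subseteq> ?P"
  proof
    fix y assume "y \<in> h ` A"
    then show "y \<in> ?P"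
      using ideal_prod.prod[of y "h ` A" "\<one>\<^bsub>S\<^esub>" "carrier S" S] by (auto dest: A.Icarr)
  qed
  ultimately show "ideal_ext S h A \<subseteq> ?P"
    unfolding ideal_ext_def by (rule S.genideal_minimal)
next
  interpret E: ideal "ideal_ext S h A" S by (rule ideal_ext_is_ideal[OF A])
  show "ideal_prod S (h ` A) (carrier S) \<subseteq> ideal_ext S h A"
  proof
    fix x assume "x \<in> ideal_prod S (h ` A) (carrier S)"
    then show "x \<in> ideal_ext S h A"
      by induction (auto intro: E.I_r_closed E.a_closed ideal_ext_incl[OF A])
  qed
qed

lemma ideal_ext_induct [consumes 2, case_names prod sum]:
  assumes "ideal A R" "x \<in> ideal_ext S h A"
    and "\<And>a s. a \<in> A \<Longrightarrow> s \<in> carrier S \<Longrightarrow> P (h a \<otimes>\<^bsub>S\<^esub> s)"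
    and "\<And>x y. x \<in> ideal_ext S h A \<Longrightarrow> y \<in> ideal_ext S h A \<Longrightarrow> P x \<Longrightarrow> P y \<Longrightarrow> P (x \<oplus>\<^bsub>S\<^esub> y)"
  shows "P x"
proof -
  have "x \<in> ideal_prod S (h ` A) (carrier S)"
    using assms(1,2) by (simp add: ideal_ext_eq_sums)
  then show ?thesis
    by induction (use assms(3,4) in \<open>auto simp: ideal_ext_eq_sums[OF assms(1)]\<close>)
qed

lemma ideal_ext_carrier: "ideal_ext S h (carrier R) = carrier S"
  using ideal.one_imp_carrier[OF ideal_ext_is_ideal[OF R.oneideal]]
    ideal_ext_incl[OF R.oneideal R.one_closed] by simp

lemma ideal_ext_zero: "ideal_ext S h {\<zero>} = {\<zero>\<^bsub>S\<^esub>}"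
  by (simp add: ideal_ext_def S.genideal_zero)

lemma ideal_ext_prod:
  assumes A: "ideal A R" and B: "ideal B R"
  shows "ideal_ext S h (ideal_prod R A B) = ideal_prod S (ideal_ext S h A) (ideal_ext S h B)"
proof
  interpret A: ideal A R by fact
  interpret B: ideal B R by fact
  have AB: "ideal (ideal_prod R A B) R" by (rule R.ideal_prod_is_ideal[OF A B])
  interpret E: ideal "ideal_ext S h (ideal_prod R A B)" S
    by (rule ideal_ext_is_ideal[OF AB])
  interpret EA: ideal "ideal_ext S h A" S by (rule ideal_ext_is_ideal[OF A])
  interpret EB: ideal "ideal_ext S h B" S by (rule ideal_ext_is_ideal[OF B])
  have "h x \<in> ideal_prod S (ideal_ext S h A) (ideal_ext S h B)" if "x \<in> ideal_prod R A B" for x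
    using that
  proof induction
    case (prod a b)
    then show ?case
      by (simp add: A.Icarr B.Icarr ideal_prod.prod ideal_ext_incl A B)
  next
    case (sum x y)
    then show ?case
      using ideal.Icarr[OF AB] by (simp add: ideal_prod.sum)
  qed
  then show "ideal_ext S h (ideal_prod R A B) \<subseteq> ideal_prod S (ideal_ext S h A) (ideal_ext S h B)"
    unfolding ideal_ext_def[of _ _ "ideal_prod R A B"]
    by (intro S.genideal_minimal S.ideal_prod_is_ideal EA.ideal_axioms EB.ideal_axioms) blast
  (* The product of two elements is treated one factor at a time: the second factor is first
     restricted to the generators of BS. *)
  have gen: "x \<otimes>\<^bsub>S\<^esub> h b \<in> ideal_ext S h (ideal_prod R A B)"
    if "x \<in> ideal_ext S h A" "b \<in> B" for x b
    using A that(1)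
  proof (induction rule: ideal_ext_induct)
    case (prod a s)
    have "h a \<otimes>\<^bsub>S\<^esub> s \<otimes>\<^bsub>S\<^esub> h b = h (a \<otimes> b) \<otimes>\<^bsub>S\<^esub> s"
      using prod that(2) A.Icarr B.Icarr by (simp add: S.m_ac)
    then show ?case
      using E.I_r_closed[OF ideal_ext_incl[OF AB ideal_prod.prod[OF prod(1) that(2)]] prod(2)]
      by simp
  next
    case (sum x y)
    then show ?case
      using that(2) by (simp add: S.l_distr EA.Icarr B.Icarr E.a_closed)
  qed
  have "x \<otimes>\<^bsub>S\<^esub> y \<in> ideal_ext S h (ideal_prod R A B)"
    if "x \<in> ideal_ext S h A" "y \<in> ideal_ext S h B" for x y
    using B that(2)
  proof (induction rule: ideal_ext_induct)
    case (prod b s)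
    have "x \<otimes>\<^bsub>S\<^esub> (h b \<otimes>\<^bsub>S\<^esub> s) = (x \<otimes>\<^bsub>S\<^esub> h b) \<otimes>\<^bsub>S\<^esub> s"
      using prod that(1) EA.Icarr B.Icarr by (simp add: S.m_assoc)
    then show ?case
      using prod that(1) by (simp add: E.I_r_closed gen)
  next
    case (sum y z)
    then show ?case
      using that(1) by (simp add: S.r_distr EA.Icarr EB.Icarr E.a_closed)
  qed
  then show "ideal_prod S (ideal_ext S h A) (ideal_ext S h B) \<subseteq> ideal_ext S h (ideal_prod R A B)"
    by (auto elim: ideal_prod.induct intro: E.a_closed)
qed

lemma ideal_ext_pow:
  assumes "ideal A R"
  shows "ideal_ext S h (ideal_pow R A n) = ideal_pow S (ideal_ext S h A) n"
proof (induction n)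
  case 0
  then show ?case by (simp only: ideal_pow_0 ideal_ext_carrier)
next
  case (Suc n)
  then show ?case
    by (simp only: ideal_pow_Suc ideal_ext_prod R.ideal_pow_is_ideal assms)
qed

end


section \<open>Exactness of a tensored sequence in terms of representatives\<close>

lemma tensor_null_zero: "0 \<in> tensor_null R N M"
  unfolding tensor_null_def by (metis generate.one one_free_Abelian_group)

lemma tensor_null_add:
  assumes "u \<in> tensor_null R N M" "v \<in> tensor_null R N M"
  shows "u + v \<in> tensor_null R N M"
  using generate.eng[OF assms[unfolded tensor_null_def]] by (simp add: tensor_null_def)

lemma tensor_null_minus:
  assumes "module R N" "module R M" "u \<in> tensor_null R N M"
  shows "- u \<in> tensor_null R N M"
proof -
  interpret normal "tensor_null R N M" "tensor_free N M"
    by (rule tensor_null_normal[OF assms(1,2)])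
  show ?thesis
    using m_inv_closed[OF assms(3)] mem_carrier[OF assms(3)] by simp
qed

lemma tensor_null_diff:
  assumes "module R N" "module R M" "u \<in> tensor_null R N M" "v \<in> tensor_null R N M"
  shows "u - v \<in> tensor_null R N M"
  using tensor_null_add[OF assms(3) tensor_null_minus[OF assms(1,2,4)]] by simp

lemma tensor_null_coset_eq_iff:
  assumes "module R N" "module R M"
  shows "tensor_null R N M #>\<^bsub>tensor_free N M\<^esub> u = tensor_null R N M #>\<^bsub>tensor_free N M\<^esub> v
           \<longleftrightarrow> u - v \<in> tensor_null R N M" (is "?C u = ?C v \<longleftrightarrow> _")
proof
  have mem: "w \<in> ?C z \<longleftrightarrow> w - z \<in> tensor_null R N M" for w z
    by (force simp: r_coset_def algebra_simps)
  {
    assume "?C u = ?C v"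
    moreover have "u \<in> ?C u" by (simp add: mem tensor_null_zero)
    ultimately show "u - v \<in> tensor_null R N M" using mem by blast
  next
    assume uv: "u - v \<in> tensor_null R N M"
    have "w - u \<in> tensor_null R N M \<longleftrightarrow> w - v \<in> tensor_null R N M" for w
      using tensor_null_add[OF _ uv, of "w - u"] tensor_null_diff[OF assms _ uv, of "w - v"]
      by auto
    then show "?C u = ?C v" by (auto simp: mem)
  }
qed

text \<open>This removes the cosets: exactness of the tensored sequence becomes a statement about
  formal sums of pairs modulo the bilinearity relations, which is the form used from here on.\<close>

lemma tensor_exact_iff:
  assumes N1: "module R N1" and N2: "module R N2" and N3: "module R N3" and M: "module R M"
    and \<phi>: "\<phi> \<in> linear_maps R N1 N2" and \<psi>: "\<psi> \<in> linear_maps R N2 N3"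
  shows "exact_at (tensor_prod R N1 M) (tensor_map R N2 M \<phi>) (tensor_prod R N2 M)
           (tensor_map R N3 M \<psi>) (tensor_prod R N3 M) \<longleftrightarrow>
    (\<forall>u \<in> carrier (tensor_free N1 M). tensor_lift \<psi> (tensor_lift \<phi> u) \<in> tensor_null R N3 M) \<and>
    (\<forall>v \<in> carrier (tensor_free N2 M). tensor_lift \<psi> v \<in> tensor_null R N3 M \<longrightarrow>
       (\<exists>u \<in> carrier (tensor_free N1 M). v - tensor_lift \<phi> u \<in> tensor_null R N2 M))"
proof -
  define C1 where "C1 = r_coset (tensor_free N1 M) (tensor_null R N1 M)"
  define C2 where "C2 = r_coset (tensor_free N2 M) (tensor_null R N2 M)"
  define C3 where "C3 = r_coset (tensor_free N3 M) (tensor_null R N3 M)"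
  have car: "carrier (tensor_prod R N1 M) = C1 ` carrier (tensor_free N1 M)"
    "carrier (tensor_prod R N2 M) = C2 ` carrier (tensor_free N2 M)"
    by (auto simp: C1_def C2_def tensor_prod_def FactGroup_def RCOSETS_def)
  have m1: "tensor_map R N2 M \<phi> (C1 u) = C2 (tensor_lift \<phi> u)"
    if "u \<in> carrier (tensor_free N1 M)" for u
    unfolding C1_def C2_def by (rule tensor_map_coset[OF N1 N2 M \<phi> that])
  have m2: "tensor_map R N3 M \<psi> (C2 v) = C3 (tensor_lift \<psi> v)"
    if "v \<in> carrier (tensor_free N2 M)" for v
    unfolding C2_def C3_def by (rule tensor_map_coset[OF N2 N3 M \<psi> that])
  have one: "\<one>\<^bsub>tensor_prod R N3 M\<^esub> = C3 0"
    by (simp add: tensor_prod_def FactGroup_def C3_def r_coset_def)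
  have e2: "C2 u = C2 v \<longleftrightarrow> u - v \<in> tensor_null R N2 M" for u v
    unfolding C2_def by (rule tensor_null_coset_eq_iff[OF N2 M])
  have e3: "C3 u = C3 v \<longleftrightarrow> u - v \<in> tensor_null R N3 M" for u v
    unfolding C3_def by (rule tensor_null_coset_eq_iff[OF N3 M])
  have m2_one: "tensor_map R N3 M \<psi> (C2 v) = C3 0 \<longleftrightarrow> tensor_lift \<psi> v \<in> tensor_null R N3 M"
    if "v \<in> carrier (tensor_free N2 M)" for v
    unfolding m2[OF that] e3 by simp
  have ker: "kernel (tensor_prod R N2 M) (tensor_prod R N3 M) (tensor_map R N3 M \<psi>)
    = C2 ` {v \<in> carrier (tensor_free N2 M). tensor_lift \<psi> v \<in> tensor_null R N3 M}"
    unfolding kernel_def car one Compr_image_eq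
    by (intro arg_cong[where f = "image C2"] Collect_cong conj_cong refl m2_one)
  have im: "tensor_map R N2 M \<phi> ` carrier (tensor_prod R N1 M)
    = (\<lambda>u. C2 (tensor_lift \<phi> u)) ` carrier (tensor_free N1 M)"
    unfolding car image_image by (rule image_cong) (simp_all add: m1 del: carrier_free_Abelian_group_iff)
  have lc: "tensor_lift \<phi> u \<in> carrier (tensor_free N2 M)" if "u \<in> carrier (tensor_free N1 M)" for u
    by (rule hom_in_carrier[OF tensor_lift_hom[OF \<phi>] that])
  (* Membership in the kernel does not depend on the representative. *)
  have tr: "tensor_lift \<psi> u \<in> tensor_null R N3 M"
    if "C2 u = C2 v" "tensor_lift \<psi> v \<in> tensor_null R N3 M" for u v
    using tensor_null_add[OF tensor_lift_null[OF N2 N3 M \<psi> that(1)[unfolded e2]] that(2)]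
    by (simp add: frag_extend_diff)
  have "exact_at (tensor_prod R N1 M) (tensor_map R N2 M \<phi>) (tensor_prod R N2 M)
           (tensor_map R N3 M \<psi>) (tensor_prod R N3 M) \<longleftrightarrow>
    (\<forall>u \<in> carrier (tensor_free N1 M). tensor_lift \<psi> (tensor_lift \<phi> u) \<in> tensor_null R N3 M) \<and>
    (\<forall>v \<in> carrier (tensor_free N2 M). tensor_lift \<psi> v \<in> tensor_null R N3 M \<longrightarrow>
       (\<exists>u \<in> carrier (tensor_free N1 M). C2 v = C2 (tensor_lift \<phi> u)))"
    (is "_ \<longleftrightarrow> ?a \<and> ?b")
  proof
    assume "exact_at (tensor_prod R N1 M) (tensor_map R N2 M \<phi>) (tensor_prod R N2 M)
           (tensor_map R N3 M \<psi>) (tensor_prod R N3 M)"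
    then have eq: "(\<lambda>u. C2 (tensor_lift \<phi> u)) ` carrier (tensor_free N1 M)
      = C2 ` {v \<in> carrier (tensor_free N2 M). tensor_lift \<psi> v \<in> tensor_null R N3 M}"
      unfolding exact_at_def ker im .
    have ?a
    proof
      fix u assume "u \<in> carrier (tensor_free N1 M)"
      then have "C2 (tensor_lift \<phi> u)
        \<in> C2 ` {v \<in> carrier (tensor_free N2 M). tensor_lift \<psi> v \<in> tensor_null R N3 M}"
        unfolding eq[symmetric] by (rule imageI)
      then show "tensor_lift \<psi> (tensor_lift \<phi> u) \<in> tensor_null R N3 M"
        using tr by blast
    qed
    moreover have ?b
    proof (intro ballI impI)
      fix v assume "v \<in> carrier (tensor_free N2 M)" "tensor_lift \<psi> v \<in> tensor_null R N3 M"
      then have "C2 v \<in> (\<lambda>u. C2 (tensor_lift \<phi> u)) ` carrier (tensor_free N1 M)"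
        unfolding eq by blast
      then show "\<exists>u \<in> carrier (tensor_free N1 M). C2 v = C2 (tensor_lift \<phi> u)" by blast
    qed
    ultimately show "?a \<and> ?b" ..
  next
    assume "?a \<and> ?b"
    then have "(\<lambda>u. C2 (tensor_lift \<phi> u)) ` carrier (tensor_free N1 M)
      = C2 ` {v \<in> carrier (tensor_free N2 M). tensor_lift \<psi> v \<in> tensor_null R N3 M}"
      using lc by blast
    then show "exact_at (tensor_prod R N1 M) (tensor_map R N2 M \<phi>) (tensor_prod R N2 M)
           (tensor_map R N3 M \<psi>) (tensor_prod R N3 M)"
      unfolding exact_at_def ker im .
  qed
  then show ?thesis unfolding e2 .
qed


section \<open>Subquotients of the ring inside the test universe\<close>

text \<open>The modules that test flatness have elements of type \<^typ>\<open>(nat \<Rightarrow> 'a) set\<close>. A coset of \<open>K\<close> is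
  coded in this type as a set of constant sequences.\<close>

definition coset_code :: "('a, 'm) ring_scheme \<Rightarrow> 'a set \<Rightarrow> 'a \<Rightarrow> (nat \<Rightarrow> 'a) set"
  where "coset_code R K x = (\<lambda>y _. y) ` (K +>\<^bsub>R\<^esub> x)"

definition coset_rep :: "(nat \<Rightarrow> 'a) set \<Rightarrow> 'a"
  where "coset_rep X = (SOME c. c \<in> X) 0"

text \<open>The image of \<open>L\<close> in \<open>R/K\<close>, that is \<open>(L + K)/K\<close>. For \<open>K = 0\<close> it is a copy of \<open>L\<close>, and for
  \<open>L = R\<close> it is \<open>R/K\<close>; treating both at once gives one set of lemmas for all modules needed. The
  representative of a coset of an element of \<open>L\<close> need not lie in \<open>L\<close>, which is harmless as the
  operations depend only on the coset.\<close>

definition subquotient ::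
    "('a, 'm) ring_scheme \<Rightarrow> 'a set \<Rightarrow> 'a set \<Rightarrow> ('a, (nat \<Rightarrow> 'a) set) module"
  where "subquotient R L K =
    \<lparr> carrier = coset_code R K ` L, monoid.mult = undefined, monoid.one = undefined,
      ring.zero = coset_code R K \<zero>\<^bsub>R\<^esub>,
      ring.add = (\<lambda>X Y. coset_code R K (coset_rep X \<oplus>\<^bsub>R\<^esub> coset_rep Y)),
      smult = (\<lambda>a X. coset_code R K (a \<otimes>\<^bsub>R\<^esub> coset_rep X)) \<rparr>"

text \<open>The projection \<open>R/K \<rightarrow> R/K'\<close> for any \<open>K \<subseteq> K'\<close>: a coset of \<open>K'\<close> can be read off from any
  representative of the given coset.\<close>

definition coset_map :: "('a, 'm) ring_scheme \<Rightarrow> 'a set \<Rightarrow> (nat \<Rightarrow> 'a) set \<Rightarrow> (nat \<Rightarrow> 'a) set"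
  where "coset_map R K X = coset_code R K (coset_rep X)"

context cring
begin

lemma coset_code_eq_iff:
  assumes "ideal K R" "x \<in> carrier R" "y \<in> carrier R"
  shows "coset_code R K x = coset_code R K y \<longleftrightarrow> x \<ominus> y \<in> K"
proof -
  have "inj (\<lambda>(y::'a) (_::nat). y)"
    by (auto intro!: injI dest: fun_cong)
  then show ?thesis
    unfolding coset_code_def quotient_eq_iff_same_a_r_cos[OF assms]
    by (rule inj_image_eq_iff)
qed

lemma coset_rep_code:
  assumes "ideal K R" "x \<in> carrier R"
  shows "coset_rep (coset_code R K x) \<in> carrier R" "coset_rep (coset_code R K x) \<ominus> x \<in> K"
proof -
  interpret K: ideal K R by fact
  have "coset_code R K x \<noteq> {}"
    using K.a_rcos_self[OF assms(2)] by (auto simp: coset_code_def)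
  then have "(SOME c. c \<in> coset_code R K x) \<in> coset_code R K x"
    by (rule some_in_eq[THEN iffD2])
  then have "coset_rep (coset_code R K x) \<in> K +> x"
    by (auto simp: coset_rep_def coset_code_def)
  then obtain k where k: "k \<in> K" "coset_rep (coset_code R K x) = k \<oplus> x"
    by (auto simp: a_r_coset_def' )
  then show "coset_rep (coset_code R K x) \<in> carrier R" "coset_rep (coset_code R K x) \<ominus> x \<in> K"
    using assms(2) K.Icarr by (auto simp: a_minus_def a_assoc r_neg)
qed

lemma coset_map_code:
  assumes K: "ideal K R" and K': "ideal K' R" and "K \<subseteq> K'" and x: "x \<in> carrier R"
  shows "coset_map R K' (coset_code R K x) = coset_code R K' x"
  using coset_rep_code[OF K x] assms
  by (auto simp: coset_map_def coset_code_eq_iff)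

lemma subquotient_add:
  assumes K: "ideal K R" and x: "x \<in> carrier R" and y: "y \<in> carrier R"
  shows "coset_code R K x \<oplus>\<^bsub>subquotient R L K\<^esub> coset_code R K y = coset_code R K (x \<oplus> y)"
proof -
  interpret K: ideal K R by fact
  note r = coset_rep_code[OF K x] and s = coset_rep_code[OF K y]
  have "(coset_rep (coset_code R K x) \<oplus> coset_rep (coset_code R K y)) \<ominus> (x \<oplus> y)
    = (coset_rep (coset_code R K x) \<ominus> x) \<oplus> (coset_rep (coset_code R K y) \<ominus> y)"
    using r(1) s(1) x y by algebra
  also have "\<dots> \<in> K" using r s by (simp add: K.a_closed)
  finally show ?thesis
    using r(1) s(1) x y by (simp add: subquotient_def coset_code_eq_iff[OF K])
qed

lemma subquotient_smult:
  assumes K: "ideal K R" and a: "a \<in> carrier R" and x: "x \<in> carrier R"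
  shows "a \<odot>\<^bsub>subquotient R L K\<^esub> coset_code R K x = coset_code R K (a \<otimes> x)"
proof -
  interpret K: ideal K R by fact
  note r = coset_rep_code[OF K x]
  have "(a \<otimes> coset_rep (coset_code R K x)) \<ominus> (a \<otimes> x)
    = a \<otimes> (coset_rep (coset_code R K x) \<ominus> x)"
    using r(1) a x by algebra
  also have "\<dots> \<in> K" using r a by (simp add: K.I_l_closed)
  finally show ?thesis
    using r(1) a x by (simp add: subquotient_def coset_code_eq_iff[OF K])
qed

lemma carrier_subquotient: "carrier (subquotient R L K) = coset_code R K ` L"
  by (simp add: subquotient_def)

lemma zero_subquotient: "\<zero>\<^bsub>subquotient R L K\<^esub> = coset_code R K \<zero>"
  by (simp add: subquotient_def)

lemma subquotient_is_module:
  assumes L: "ideal L R" and K: "ideal K R"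
  shows "module R (subquotient R L K)"
proof -
  interpret L: ideal L R by fact
  note [simp] = subquotient_add[OF K] subquotient_smult[OF K] carrier_subquotient zero_subquotient
    L.Icarr L.a_closed L.I_l_closed
  have inv: "\<exists>y\<in>L. coset_code R K (x \<oplus> y) = coset_code R K \<zero>" if "x \<in> L" for x
    using that r_neg[of x] L.a_inv_closed by (metis L.Icarr)
  have "abelian_group (subquotient R L K)"
    by (rule abelian_groupI) (auto simp: a_ac inv)
  then show ?thesis
    by (intro moduleI is_cring) (auto simp: l_distr r_distr m_assoc)
qed

lemma subquotient_inclusion_linear:
  assumes K: "ideal K R" and L: "ideal L R" "L \<subseteq> L'" 
  shows "(\<lambda>X. X) \<in> linear_maps R (subquotient R L K) (subquotient R L' K)"
  using assms ideal.Icarr[OF L(1)]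
  by (auto simp: linear_maps_def hom_def carrier_subquotient subquotient_add subquotient_smult)

lemma coset_map_linear:
  assumes K: "ideal K R" and K': "ideal K' R" and L: "ideal L R" and "K \<subseteq> K'" "L \<subseteq> L'"
  shows "coset_map R K' \<in> linear_maps R (subquotient R L K) (subquotient R L' K')"
proof -
  interpret L: ideal L R by fact
  show ?thesis
    using assms
    by (auto simp: linear_maps_def hom_def carrier_subquotient subquotient_add subquotient_smult
        coset_map_code L.Icarr)
qed

text \<open>The kernel of \<open>L \<rightarrow> R/K\<close> is \<open>L \<inter> K\<close>, so exactness detects both intersections (with
  \<open>L1 = L \<inter> K\<close>) and equality of ideals (with \<open>L = R\<close>).\<close>

lemma subquotient_exact_iff:
  assumes L1: "ideal L1 R" and L: "ideal L R" and K: "ideal K R"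
  shows "exact_at (add_monoid (subquotient R L1 {\<zero>})) (\<lambda>X. X) (add_monoid (subquotient R L {\<zero>}))
           (coset_map R K) (add_monoid (subquotient R (carrier R) K)) \<longleftrightarrow> L1 = L \<inter> K"
proof -
  interpret K: ideal K R by fact
  have inj: "inj_on (coset_code R {\<zero>}) (carrier R)"
    by (rule inj_onI) (simp add: coset_code_eq_iff[OF zeroideal])
  have "coset_map R K (coset_code R {\<zero>} x) = coset_code R K \<zero> \<longleftrightarrow> x \<in> K" if "x \<in> L" for x
    using ideal.Icarr[OF L that]
    by (simp add: coset_map_code[OF zeroideal K] coset_code_eq_iff[OF K] a_minus_def)
  then have "kernel (add_monoid (subquotient R L {\<zero>})) (add_monoid (subquotient R (carrier R) K))
      (coset_map R K) = coset_code R {\<zero>} ` (L \<inter> K)"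
    by (auto simp: kernel_def carrier_subquotient zero_subquotient)
  moreover have "coset_code R {\<zero>} ` L1 = coset_code R {\<zero>} ` (L \<inter> K) \<longleftrightarrow> L1 = L \<inter> K"
    using inj_on_image_eq_iff[OF inj, of L1 "L \<inter> K"] ideal.Icarr[OF L1] K.Icarr by blast
  ultimately show ?thesis
    by (simp add: exact_at_def carrier_subquotient)
qed

end


section \<open>Base change of cyclic modules\<close>

context ring_hom_cring
begin

abbreviation (input) "base_module \<equiv> restrict_scalars h S"

abbreviation (input) "quot K \<equiv> subquotient R (carrier R) K"

text \<open>The pure tensor \<open>r \<otimes> s\<close> in \<open>R/K \<otimes> S\<close>, before passing to classes. Two formal sums have the
  same class iff their difference lies in \<^const>\<open>tensor_null\<close>.\<close>

abbreviation (input) "pt K r s \<equiv> frag_of (coset_code R K r, s)"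

lemma base_module_is_module: "module R base_module"
  by (rule module_restrict_scalars[OF R.is_cring S.is_cring homh])

lemma base_module_simps:
  "carrier base_module = carrier S" "s \<oplus>\<^bsub>base_module\<^esub> t = s \<oplus>\<^bsub>S\<^esub> t"
  "a \<odot>\<^bsub>base_module\<^esub> s = h a \<otimes>\<^bsub>S\<^esub> s"
  by (simp_all add: restrict_scalars_def)

lemma quot_is_module:
  assumes "ideal K R"
  shows "module R (quot K)"
  by (rule R.subquotient_is_module[OF R.oneideal assms])

lemma pt_add_left:
  assumes K: "ideal K R" and "r \<in> carrier R" "r' \<in> carrier R" "s \<in> carrier S"
  shows "pt K (r \<oplus> r') s - pt K r s - pt K r' s \<in> tensor_null R (quot K) base_module"
  unfolding tensor_null_def R.subquotient_add[OF K assms(2,3), of "carrier R", symmetric]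
  by (rule generate.incl) (use assms in
      \<open>auto simp: tensor_relators_def base_module_simps R.carrier_subquotient\<close>)

lemma pt_add_right:
  assumes K: "ideal K R" and "r \<in> carrier R" "s \<in> carrier S" "t \<in> carrier S"
  shows "pt K r (s \<oplus>\<^bsub>S\<^esub> t) - pt K r s - pt K r t \<in> tensor_null R (quot K) base_module"
  unfolding tensor_null_def base_module_simps(2)[symmetric]
  by (rule generate.incl) (use assms in
      \<open>auto simp: tensor_relators_def base_module_simps(1) R.carrier_subquotient\<close>)

lemma pt_scalar:
  assumes K: "ideal K R" and r: "r \<in> carrier R" and s: "s \<in> carrier S"
  shows "pt K r s - pt K \<one> (h r \<otimes>\<^bsub>S\<^esub> s) \<in> tensor_null R (quot K) base_module"
proof -
  have "frag_of (r \<odot>\<^bsub>quot K\<^esub> coset_code R K \<one>, s)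
      - frag_of (coset_code R K \<one>, r \<odot>\<^bsub>base_module\<^esub> s) \<in> tensor_relators R (quot K) base_module"
    using assms R.one_closed
    unfolding tensor_relators_def R.carrier_subquotient base_module_simps(1) by blast
  then show ?thesis
    using generate.incl
    by (fastforce simp: tensor_null_def base_module_simps R.subquotient_smult[OF K r] r)
qed

text \<open>The relation \<open>(0 + 0) \<otimes> s = 0 \<otimes> s + 0 \<otimes> s\<close> is the negative of the formal pair.\<close>

lemma pt_zero_left:
  assumes K: "ideal K R" and s: "s \<in> carrier S"
  shows "pt K \<zero> s \<in> tensor_null R (quot K) base_module"
  using tensor_null_minus[OF quot_is_module[OF K] base_module_is_module
      pt_add_left[OF K R.zero_closed R.zero_closed s]]
  by simp

text \<open>For \<open>k \<in> K\<close> one has \<open>1 \<otimes> h k \<cdot> s = k \<otimes> s = 0 \<otimes> s = 0\<close>, and such products generate \<open>KS\<close>.\<close>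

lemma pt_one_null:
  assumes K: "ideal K R" and x: "x \<in> ideal_ext S h K"
  shows "pt K \<one> x \<in> tensor_null R (quot K) base_module"
  using K x
proof (induction rule: ideal_ext_induct)
  case (prod k s)
  interpret K: ideal K R by (rule K)
  have "coset_code R K k = coset_code R K \<zero>"
    using prod(1) K.Icarr by (simp add: R.coset_code_eq_iff[OF K] a_minus_def)
  then have "pt K k s \<in> tensor_null R (quot K) base_module"
    using pt_zero_left[OF K prod(2)] by simp
  from tensor_null_diff[OF quot_is_module[OF K] base_module_is_module this
      pt_scalar[OF K K.Icarr[OF prod(1)] prod(2)]]
  show ?case by simp
next
  case (sum x y)
  note c = ideal.Icarr[OF ideal_ext_is_ideal[OF K]]
  from tensor_null_add[OF pt_add_right[OF K R.one_closed c[OF sum(1)] c[OF sum(2)]]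
      tensor_null_add[OF sum(3,4)]]
  show ?case by simp
qed

text \<open>The converse is the one place where a map out of the tensor product is needed. Instead of
  \<open>R/K \<otimes> S \<rightarrow> S/KS\<close>, the proof uses the additive map \<open>ev\<close> from formal sums to \<open>S\<close> that sends a pair
  \<open>(X, s)\<close> to \<open>h c \<cdot> s\<close>, where \<open>c\<close> is the chosen representative of the coset \<open>X\<close>. It is bilinear
  only up to \<open>KS\<close>, so it maps the bilinearity relations into \<open>KS\<close>, which is enough.\<close>

lemma pt_one_nullD:
  assumes K: "ideal K R" and x: "x \<in> carrier S"
    and null: "pt K \<one> x \<in> tensor_null R (quot K) base_module"
  shows "x \<in> ideal_ext S h K"
proof -
  interpret K: ideal K R by (rule K)
  interpret E: ideal "ideal_ext S h K" S by (rule ideal_ext_is_ideal[OF K])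
  let ?F = "tensor_free (quot K) base_module"
  have rep: "coset_rep X \<in> carrier R" if "X \<in> carrier (quot K)" for X
    using that R.coset_rep_code(1)[OF K] by (auto simp: R.carrier_subquotient)
  have "(\<lambda>(X, s). h (coset_rep X) \<otimes>\<^bsub>S\<^esub> s) ` (carrier (quot K) \<times> carrier base_module)
      \<subseteq> carrier (add_monoid S)"
    using rep by (auto simp: base_module_simps)
  then obtain ev where ev: "ev \<in> hom ?F (add_monoid S)"
    and ev_of0: "\<And>p. p \<in> carrier (quot K) \<times> carrier base_module \<Longrightarrow>
      ev (frag_of p) = (\<lambda>(X, s). h (coset_rep X) \<otimes>\<^bsub>S\<^esub> s) p"
    by (rule comm_group.free_Abelian_group_universal[OF S.a_comm_group]) blast
  have ev_of: "ev (frag_of (X, s)) = h (coset_rep X) \<otimes>\<^bsub>S\<^esub> s"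
    if "X \<in> carrier (quot K)" "s \<in> carrier S" for X s
    using ev_of0[of "(X, s)"] that by (simp add: base_module_simps)
  interpret ev: group_hom ?F "add_monoid S" ev
    by (intro group_hom.intro group_hom_axioms.intro ev group_free_Abelian_group S.add.is_group)
  have evc: "ev u \<in> carrier S" if "u \<in> carrier ?F" for u
    using ev.hom_closed[OF that] by simp
  have ev_minus: "ev (- u) = \<ominus>\<^bsub>S\<^esub> ev u" if "u \<in> carrier ?F" for u
    using ev.hom_inv[OF that] that by (simp add: a_inv_def)
  have ev_add: "ev (u + v) = ev u \<oplus>\<^bsub>S\<^esub> ev v" if "u \<in> carrier ?F" "v \<in> carrier ?F" for u v
    using ev.hom_mult[OF that] by simp
  have ev_diff: "ev (u - v) = ev u \<ominus>\<^bsub>S\<^esub> ev v" if "u \<in> carrier ?F" "v \<in> carrier ?F" for u v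
  proof -
    have "- v \<in> carrier ?F" using that(2) by simp
    then show ?thesis
      using ev_add[OF that(1), of "- v"] ev_minus[OF that(2)] by (simp add: a_minus_def)
  qed
  have small: "h k \<otimes>\<^bsub>S\<^esub> s \<in> ideal_ext S h K" if "k \<in> K" "s \<in> carrier S" for k s
    by (rule E.I_r_closed[OF ideal_ext_incl[OF K that(1)] that(2)])
  have rel: "ev u \<in> ideal_ext S h K" if "u \<in> tensor_relators R (quot K) base_module" for u
    using that unfolding tensor_relators_def Un_iff mem_Collect_eq base_module_simps
  proof (elim disjE exE conjE, goal_cases)
    case (1 X X' s)
    let ?x = "coset_rep X" and ?x' = "coset_rep X'" and ?z = "coset_rep (X \<oplus>\<^bsub>quot K\<^esub> X')"
    note x = rep[OF 1(2)] and x' = rep[OF 1(3)]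
    have Z: "X \<oplus>\<^bsub>quot K\<^esub> X' = coset_code R K (?x \<oplus> ?x')"
      by (simp add: subquotient_def)
    have z: "?z \<in> carrier R" "?z \<ominus> (?x \<oplus> ?x') \<in> K"
      using R.coset_rep_code[OF K, of "?x \<oplus> ?x'"] x x' by (simp_all add: Z)
    have Zc: "X \<oplus>\<^bsub>quot K\<^esub> X' \<in> carrier (quot K)"
      using x x' unfolding Z by (simp add: R.carrier_subquotient)
    have "ev u = h ?z \<otimes>\<^bsub>S\<^esub> s \<ominus>\<^bsub>S\<^esub> h ?x \<otimes>\<^bsub>S\<^esub> s \<ominus>\<^bsub>S\<^esub> h ?x' \<otimes>\<^bsub>S\<^esub> s"
      using 1 Zc by (simp add: ev_diff ev_of base_module_simps diff_in_free_Abelian_group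
          del: carrier_free_Abelian_group_iff)
    also have "\<dots> = h (?z \<ominus> (?x \<oplus> ?x')) \<otimes>\<^bsub>S\<^esub> s"
      using x x' z(1) 1(4)
      by (simp add: a_minus_def S.l_distr S.l_minus S.minus_add S.a_ac)
    finally show ?case
      using small[OF z(2) 1(4)] by simp
  next
    case (2 X s t)
    have "ev u = h (coset_rep X) \<otimes>\<^bsub>S\<^esub> (s \<oplus>\<^bsub>S\<^esub> t) \<ominus>\<^bsub>S\<^esub> h (coset_rep X) \<otimes>\<^bsub>S\<^esub> s
        \<ominus>\<^bsub>S\<^esub> h (coset_rep X) \<otimes>\<^bsub>S\<^esub> t"
      using 2 by (simp add: ev_diff ev_of base_module_simps diff_in_free_Abelian_group
          del: carrier_free_Abelian_group_iff)
    also have "\<dots> = \<zero>\<^bsub>S\<^esub>"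
      using 2 rep[OF 2(2)] S.r_neg[of "h (coset_rep X) \<otimes>\<^bsub>S\<^esub> s \<oplus>\<^bsub>S\<^esub> h (coset_rep X) \<otimes>\<^bsub>S\<^esub> t"]
      by (simp add: a_minus_def S.r_distr S.minus_add S.a_assoc)
    finally show ?case by simp
  next
    case (3 a X s)
    let ?x = "coset_rep X" and ?z = "coset_rep (a \<odot>\<^bsub>quot K\<^esub> X)"
    note x = rep[OF 3(3)]
    have Z: "a \<odot>\<^bsub>quot K\<^esub> X = coset_code R K (a \<otimes> ?x)"
      by (simp add: subquotient_def)
    have z: "?z \<in> carrier R" "?z \<ominus> a \<otimes> ?x \<in> K"
      using R.coset_rep_code[OF K, of "a \<otimes> ?x"] x 3(2) by (simp_all add: Z)
    have Zc: "a \<odot>\<^bsub>quot K\<^esub> X \<in> carrier (quot K)"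
      using x 3(2) unfolding Z by (simp add: R.carrier_subquotient)
    have "ev u = h ?z \<otimes>\<^bsub>S\<^esub> s \<ominus>\<^bsub>S\<^esub> h ?x \<otimes>\<^bsub>S\<^esub> (h a \<otimes>\<^bsub>S\<^esub> s)"
      using 3 Zc by (simp add: ev_diff ev_of base_module_simps
          del: carrier_free_Abelian_group_iff)
    also have "\<dots> = h (?z \<ominus> a \<otimes> ?x) \<otimes>\<^bsub>S\<^esub> s"
      using x z(1) 3(2,4)
      by (simp add: a_minus_def S.l_distr S.r_distr S.l_minus S.r_minus S.m_ac)
    finally show ?case
      using small[OF z(2) 3(4)] by simp
  qed
  have gen: "ev u \<in> ideal_ext S h K" if "u \<in> tensor_null R (quot K) base_module" for u
    using that unfolding tensor_null_def
  proof (induction rule: generate.induct)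
    case one
    then show ?case using ev.hom_one by simp
  next
    case (incl u)
    then show ?case by (rule rel)
  next
    case (inv u)
    have "u \<in> carrier ?F"
      by (rule subsetD[OF tensor_relators_closed[OF quot_is_module[OF K] base_module_is_module] inv])
    then show ?case
      using rel[OF inv] ev.hom_inv[of u] by (simp add: a_inv_def[symmetric])
  next
    case (eng u v)
    have "generate ?F (tensor_relators R (quot K) base_module) \<subseteq> carrier ?F"
      by (rule group.generate_incl[OF group_free_Abelian_group
            tensor_relators_closed[OF quot_is_module[OF K] base_module_is_module]])
    then show ?case
      using eng ev.hom_mult[of u v] by (simp add: E.a_closed subset_iff
          del: carrier_free_Abelian_group_iff mult_free_Abelian_group)
  qed
  (* The representative of the coset of 1 need not be 1; it differs from 1 by an element of K. *)
  let ?e = "coset_rep (coset_code R K \<one>)"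
  note e = R.coset_rep_code[OF K R.one_closed]
  have "h ?e \<otimes>\<^bsub>S\<^esub> x \<in> ideal_ext S h K"
    using gen[OF null] x by (simp add: ev_of R.carrier_subquotient)
  then have "h ?e \<otimes>\<^bsub>S\<^esub> x \<ominus>\<^bsub>S\<^esub> h (?e \<ominus> \<one>) \<otimes>\<^bsub>S\<^esub> x \<in> ideal_ext S h K"
    using small[OF e(2) x] by (simp add: a_minus_def E.a_closed E.a_inv_closed)
  also have "h ?e \<otimes>\<^bsub>S\<^esub> x \<ominus>\<^bsub>S\<^esub> h (?e \<ominus> \<one>) \<otimes>\<^bsub>S\<^esub> x = x"
    using e(1) x by (simp add: a_minus_def S.l_distr S.l_minus S.minus_add S.r_neg1 S.r_neg2 S.r_neg)
  finally show ?thesis .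
qed

text \<open>If \<open>x = \<Sum> h a\<^sub>i \<cdot> s\<^sub>i\<close> with \<open>a\<^sub>i \<in> L\<close>, then \<open>\<Sum> a\<^sub>i \<otimes> s\<^sub>i\<close> is an element of \<open>L \<otimes> S\<close> that becomes
  \<open>1 \<otimes> x\<close> in \<open>R \<otimes> S\<close>. As \<open>L\<close> and \<open>R\<close> are both coded with cosets of \<open>0\<close>, the map \<open>L \<otimes> S \<rightarrow> R \<otimes> S\<close>
  does not change formal sums.\<close>

lemma ideal_ext_obtain_tensor:
  assumes L: "ideal L R" and x: "x \<in> ideal_ext S h L"
  shows "\<exists>u \<in> carrier (tensor_free (subquotient R L {\<zero>}) base_module).
    u - pt {\<zero>} \<one> x \<in> tensor_null R (quot {\<zero>}) base_module"
  using L x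
proof (induction rule: ideal_ext_induct)
  case (prod a s)
  show ?case
    using prod pt_scalar[OF R.zeroideal ideal.Icarr[OF L prod(1)] prod(2)]
    by (intro bexI[of _ "pt {\<zero>} a s"]) (auto simp: R.carrier_subquotient base_module_simps)
next
  case (sum x y)
  note c = ideal.Icarr[OF ideal_ext_is_ideal[OF L]]
  from sum obtain u v where
    u: "u \<in> carrier (tensor_free (subquotient R L {\<zero>}) base_module)"
      "u - pt {\<zero>} \<one> x \<in> tensor_null R (quot {\<zero>}) base_module" and
    v: "v \<in> carrier (tensor_free (subquotient R L {\<zero>}) base_module)"
      "v - pt {\<zero>} \<one> y \<in> tensor_null R (quot {\<zero>}) base_module"
    by blast
  have "u + v \<in> carrier (tensor_free (subquotient R L {\<zero>}) base_module)"
    using monoid.m_closed[OF group.is_monoid[OF group_free_Abelian_group] u(1) v(1)] by simp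
  moreover have "u + v - pt {\<zero>} \<one> (x \<oplus>\<^bsub>S\<^esub> y) \<in> tensor_null R (quot {\<zero>}) base_module"
    using tensor_null_diff[OF quot_is_module[OF R.zeroideal] base_module_is_module
        tensor_null_add[OF u(2) v(2)]
        pt_add_right[OF R.zeroideal R.one_closed c[OF sum(1)] c[OF sum(2)]]]
    by (simp add: algebra_simps)
  ultimately show ?case by blast
qed

text \<open>Conversely, \<open>\<Sum> a\<^sub>i \<otimes> s\<^sub>i\<close> with \<open>a\<^sub>i \<in> L\<close> equals \<open>1 \<otimes> \<Sum> h a\<^sub>i \<cdot> s\<^sub>i\<close> in \<open>R \<otimes> S\<close>. With \<open>L = R\<close> this
  says that every element of \<open>R \<otimes> S\<close> has the form \<open>1 \<otimes> x\<close>.\<close>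

lemma tensor_obtain_ideal_ext:
  assumes L: "ideal L R"
    and u: "u \<in> carrier (tensor_free (subquotient R L {\<zero>}) base_module)"
  shows "\<exists>x \<in> ideal_ext S h L. u - pt {\<zero>} \<one> x \<in> tensor_null R (quot {\<zero>}) base_module"
  using u unfolding carrier_free_Abelian_group_iff
proof (induction rule: frag_induction)
  interpret E: ideal "ideal_ext S h L" S by (rule ideal_ext_is_ideal[OF L])
  note null_diff = tensor_null_diff[OF quot_is_module[OF R.zeroideal] base_module_is_module]
  {
    case zero
    have "pt {\<zero>} \<one> \<zero>\<^bsub>S\<^esub> \<in> tensor_null R (quot {\<zero>}) base_module"
      by (rule pt_one_null[OF R.zeroideal]) (simp add: ideal_ext_zero)
    from null_diff[OF tensor_null_zero this] show ?case
      using E.zero_closed by blast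
  next
    case (one p)
    then obtain a s where p: "p = (coset_code R {\<zero>} a, s)" "a \<in> L" "s \<in> carrier S"
      by (auto simp: R.carrier_subquotient base_module_simps)
    show ?case
      using pt_scalar[OF R.zeroideal ideal.Icarr[OF L p(2)] p(3)]
        E.I_r_closed[OF ideal_ext_incl[OF L p(2)] p(3)]
      unfolding p(1) by blast
  next
    case (diff u v)
    then obtain x y where x: "x \<in> ideal_ext S h L" and y: "y \<in> ideal_ext S h L"
      and u: "u - pt {\<zero>} \<one> x \<in> tensor_null R (quot {\<zero>}) base_module"
      and v: "v - pt {\<zero>} \<one> y \<in> tensor_null R (quot {\<zero>}) base_module"
      by blast
    have xy: "x \<ominus>\<^bsub>S\<^esub> y \<in> ideal_ext S h L"
      using x y by (simp add: a_minus_def E.a_closed E.a_inv_closed)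
    have "(x \<ominus>\<^bsub>S\<^esub> y) \<oplus>\<^bsub>S\<^esub> y = x"
      using E.Icarr x y by (simp add: a_minus_def S.a_assoc S.l_neg)
    then have "pt {\<zero>} \<one> x - pt {\<zero>} \<one> (x \<ominus>\<^bsub>S\<^esub> y) - pt {\<zero>} \<one> y
        \<in> tensor_null R (quot {\<zero>}) base_module"
      using pt_add_right[OF R.zeroideal R.one_closed E.Icarr[OF xy] E.Icarr[OF y]] by simp
    from tensor_null_add[OF null_diff[OF u v] this]
    have "u - v - pt {\<zero>} \<one> (x \<ominus>\<^bsub>S\<^esub> y) \<in> tensor_null R (quot {\<zero>}) base_module"
      by (simp add: algebra_simps)
    with xy show ?case by blast
  }
qed


section \<open>Flatness and extension of ideals\<close>

text \<open>The kernel of \<open>R \<otimes> S \<rightarrow> R/K \<otimes> S\<close> corresponds to \<open>KS\<close> under \<open>1 \<otimes> x \<mapsto> x\<close>.\<close>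

lemma tensor_lift_coset_map_null_iff:
  assumes K: "ideal K R" and x: "x \<in> carrier S"
    and ux: "u - pt {\<zero>} \<one> x \<in> tensor_null R (quot {\<zero>}) base_module"
  shows "tensor_lift (coset_map R K) u \<in> tensor_null R (quot K) base_module \<longleftrightarrow> x \<in> ideal_ext S h K"
proof -
  interpret K: ideal K R by (rule K)
  have "coset_map R K \<in> linear_maps R (quot {\<zero>}) (quot K)"
    by (rule R.coset_map_linear[OF R.zeroideal K R.oneideal]) auto
  from tensor_lift_null[OF quot_is_module[OF R.zeroideal] quot_is_module[OF K]
      base_module_is_module this ux]
  have d: "tensor_lift (coset_map R K) u - pt K \<one> x \<in> tensor_null R (quot K) base_module"
    by (simp add: frag_extend_diff R.coset_map_code[OF R.zeroideal K])
  have "tensor_lift (coset_map R K) u \<in> tensor_null R (quot K) base_module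
      \<longleftrightarrow> pt K \<one> x \<in> tensor_null R (quot K) base_module"
    using tensor_null_add[OF d, of "pt K \<one> x"]
      tensor_null_diff[OF quot_is_module[OF K] base_module_is_module _ d,
        of "tensor_lift (coset_map R K) u"]
    by auto
  also have "\<dots> \<longleftrightarrow> x \<in> ideal_ext S h K"
    using pt_one_null[OF K] pt_one_nullD[OF K x] by blast
  finally show ?thesis .
qed

lemma tensor_lift_id: "tensor_lift (\<lambda>X. X) u = u"
proof -
  have "tensor_lift (\<lambda>X. X) u = frag_extend frag_of u"
    by (rule arg_cong[where f = "\<lambda>g. frag_extend g u"]) auto
  then show ?thesis using frag_expansion[of u] by simp
qed

text \<open>Tensor \<open>A \<inter> B \<rightarrow> B \<rightarrow> R/A\<close> with \<open>S\<close>. Using \<open>B\<close> in the middle avoids the direct sum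
  \<open>R/A \<oplus> R/B\<close> of the symmetric argument.\<close>

lemma flat_ideal_ext_Int:
  assumes flat: "flat_module R base_module" and A: "ideal A R" and B: "ideal B R"
  shows "ideal_ext S h (A \<inter> B) = ideal_ext S h A \<inter> ideal_ext S h B"
proof (intro equalityI Int_greatest ideal_ext_mono Int_lower1 Int_lower2 subsetI)
  fix x assume "x \<in> ideal_ext S h A \<inter> ideal_ext S h B"
  then have xA: "x \<in> ideal_ext S h A" and xB: "x \<in> ideal_ext S h B" by auto
  note null_diff = tensor_null_diff[OF quot_is_module[OF R.zeroideal] base_module_is_module]
  note Z = R.zeroideal
  have AB: "ideal (A \<inter> B) R" by (rule R.i_intersect[OF A B])
  interpret E: ideal "ideal_ext S h (A \<inter> B)" S by (rule ideal_ext_is_ideal[OF AB])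
  have xc: "x \<in> carrier S" by (rule ideal.Icarr[OF ideal_ext_is_ideal[OF A] xA])
  have AR: "{\<zero>} \<subseteq> A" "B \<subseteq> carrier R"
    using additive_subgroup.zero_closed[OF ideal.axioms(1)[OF A]] ideal.Icarr[OF B] by auto
  note m1 = R.subquotient_is_module[OF AB Z] and m2 = R.subquotient_is_module[OF B Z]
    and m3 = quot_is_module[OF A]
    and l1 = R.subquotient_inclusion_linear[OF Z AB Int_lower2]
    and l2 = R.coset_map_linear[OF Z A B AR]
  have "exact_at (add_monoid (subquotient R (A \<inter> B) {\<zero>})) (\<lambda>X. X)
      (add_monoid (subquotient R B {\<zero>})) (coset_map R A) (add_monoid (quot A))"
    by (simp add: R.subquotient_exact_iff[OF AB B A] Int_commute)
  then have "exact_at (tensor_prod R (subquotient R (A \<inter> B) {\<zero>}) base_module)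
      (tensor_map R (subquotient R B {\<zero>}) base_module (\<lambda>X. X))
      (tensor_prod R (subquotient R B {\<zero>}) base_module)
      (tensor_map R (quot A) base_module (coset_map R A)) (tensor_prod R (quot A) base_module)"
    using flat m1 m2 m3 l1 l2 unfolding flat_module_def by blast
  then have ex: "\<exists>v \<in> carrier (tensor_free (subquotient R (A \<inter> B) {\<zero>}) base_module).
      u - v \<in> tensor_null R (subquotient R B {\<zero>}) base_module"
    if "u \<in> carrier (tensor_free (subquotient R B {\<zero>}) base_module)"
      "tensor_lift (coset_map R A) u \<in> tensor_null R (quot A) base_module" for u
    using that unfolding tensor_exact_iff[OF m1 m2 m3 base_module_is_module l1 l2] tensor_lift_id
    by blast
  obtain u where u: "u \<in> carrier (tensor_free (subquotient R B {\<zero>}) base_module)"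
    and ux: "u - pt {\<zero>} \<one> x \<in> tensor_null R (quot {\<zero>}) base_module"
    using ideal_ext_obtain_tensor[OF B xB] by blast
  have "tensor_lift (coset_map R A) u \<in> tensor_null R (quot A) base_module"
    using tensor_lift_coset_map_null_iff[OF A xc ux] xA by simp
  from ex[OF u this] obtain v
    where v: "v \<in> carrier (tensor_free (subquotient R (A \<inter> B) {\<zero>}) base_module)"
      and uv0: "u - v \<in> tensor_null R (subquotient R B {\<zero>}) base_module" by blast
  have uv: "u - v \<in> tensor_null R (quot {\<zero>}) base_module"
    using tensor_lift_null[OF m2 quot_is_module[OF Z] base_module_is_module
        R.subquotient_inclusion_linear[OF Z B AR(2)] uv0]
    by (simp add: tensor_lift_id)
  obtain y where y: "y \<in> ideal_ext S h (A \<inter> B)"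
    and vy: "v - pt {\<zero>} \<one> y \<in> tensor_null R (quot {\<zero>}) base_module"
    using tensor_obtain_ideal_ext[OF AB v] by blast
  have yc: "y \<in> carrier S" by (rule E.Icarr[OF y])
  (* x and y have the same image in R \<otimes> S, and the map from S to R \<otimes> S sending x to 1 \<otimes> x is
     injective. *)
  have "pt {\<zero>} \<one> x - pt {\<zero>} \<one> y \<in> tensor_null R (quot {\<zero>}) base_module"
    using null_diff[OF tensor_null_add[OF uv vy] ux] by (simp add: algebra_simps)
  moreover have "(x \<ominus>\<^bsub>S\<^esub> y) \<oplus>\<^bsub>S\<^esub> y = x"
    using xc yc by (simp add: a_minus_def S.a_assoc S.l_neg)
  moreover have "x \<ominus>\<^bsub>S\<^esub> y \<in> carrier S" using xc yc by simp
  ultimately have "pt {\<zero>} \<one> (x \<ominus>\<^bsub>S\<^esub> y) \<in> tensor_null R (quot {\<zero>}) base_module"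
    using null_diff[OF _ pt_add_right[OF Z R.one_closed, of "x \<ominus>\<^bsub>S\<^esub> y" y]] yc
    by fastforce
  from pt_one_nullD[OF Z _ this] have "x \<ominus>\<^bsub>S\<^esub> y = \<zero>\<^bsub>S\<^esub>"
    using xc yc by (simp add: ideal_ext_zero)
  then have "x = y" using xc yc by (simp add: S.r_right_minus_eq)
  with y show "x \<in> ideal_ext S h (A \<inter> B)" by simp
qed

text \<open>Tensor \<open>A \<rightarrow> R \<rightarrow> R/B\<close> with \<open>S\<close>. In the resulting sequence the kernel and the image at
  \<open>R \<otimes> S\<close> are the classes \<open>1 \<otimes> x\<close> with \<open>x \<in> BS\<close> and \<open>x \<in> AS\<close>. Since faithful flatness reflects exactness for any
  two composable maps, \<open>AS = BS\<close> gives \<open>A = B\<close> directly, without treating the inclusions one by one.\<close>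

lemma faithfully_flat_ideal_ext_inj:
  assumes ff: "faithfully_flat_module R base_module" and A: "ideal A R" and B: "ideal B R"
    and eq: "ideal_ext S h A = ideal_ext S h B"
  shows "A = B"
proof -
  note Z = R.zeroideal
  have sub: "{\<zero>} \<subseteq> B" "A \<subseteq> carrier R" "B \<subseteq> carrier R"
    using additive_subgroup.zero_closed[OF ideal.axioms(1)[OF B]] ideal.Icarr[OF A]
      ideal.Icarr[OF B] by auto
  note m1 = R.subquotient_is_module[OF A Z] and m2 = quot_is_module[OF Z]
    and m3 = quot_is_module[OF B] and M = base_module_is_module
    and l1 = R.subquotient_inclusion_linear[OF Z A sub(2)]
    and l2 = R.coset_map_linear[OF Z B R.oneideal sub(1) order_refl]
  have EAc: "x \<in> carrier S" if "x \<in> ideal_ext S h A" for x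
    by (rule ideal.Icarr[OF ideal_ext_is_ideal[OF A] that])
  have "exact_at (tensor_prod R (subquotient R A {\<zero>}) base_module)
      (tensor_map R (quot {\<zero>}) base_module (\<lambda>X. X)) (tensor_prod R (quot {\<zero>}) base_module)
      (tensor_map R (quot B) base_module (coset_map R B)) (tensor_prod R (quot B) base_module)"
    unfolding tensor_exact_iff[OF m1 m2 m3 M l1 l2] tensor_lift_id
  proof (intro conjI ballI impI)
    fix u assume "u \<in> carrier (tensor_free (subquotient R A {\<zero>}) base_module)"
    then obtain x where x: "x \<in> ideal_ext S h A"
      and ux: "u - pt {\<zero>} \<one> x \<in> tensor_null R (quot {\<zero>}) base_module"
      using tensor_obtain_ideal_ext[OF A] by blast
    show "tensor_lift (coset_map R B) u \<in> tensor_null R (quot B) base_module"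
      using tensor_lift_coset_map_null_iff[OF B EAc[OF x] ux] x eq by simp
  next
    fix v assume v: "v \<in> carrier (tensor_free (quot {\<zero>}) base_module)"
      and null: "tensor_lift (coset_map R B) v \<in> tensor_null R (quot B) base_module"
    obtain x where x: "x \<in> carrier S"
      and vx: "v - pt {\<zero>} \<one> x \<in> tensor_null R (quot {\<zero>}) base_module"
      using tensor_obtain_ideal_ext[OF R.oneideal v] unfolding ideal_ext_carrier by blast
    have "x \<in> ideal_ext S h A"
      using tensor_lift_coset_map_null_iff[OF B x vx] null eq by simp
    then obtain u where u: "u \<in> carrier (tensor_free (subquotient R A {\<zero>}) base_module)"
      and ux: "u - pt {\<zero>} \<one> x \<in> tensor_null R (quot {\<zero>}) base_module"
      using ideal_ext_obtain_tensor[OF A] by blast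
    have "v - u \<in> tensor_null R (quot {\<zero>}) base_module"
      using tensor_null_diff[OF m2 M vx ux] by simp
    with u show "\<exists>u \<in> carrier (tensor_free (subquotient R A {\<zero>}) base_module).
        v - u \<in> tensor_null R (quot {\<zero>}) base_module" by blast
  qed
  then have "exact_at (add_monoid (subquotient R A {\<zero>})) (\<lambda>X. X) (add_monoid (quot {\<zero>}))
      (coset_map R B) (add_monoid (quot B))"
    using ff m1 m2 m3 l1 l2 unfolding faithfully_flat_module_def by blast
  then have "A = carrier R \<inter> B"
    by (simp add: R.subquotient_exact_iff[OF A R.oneideal B])
  with sub(3) show ?thesis by auto
qed


section \<open>Demotions under base change\<close>

lemma flat_demotion_ext:
  assumes flat: "flat_module R base_module" and dem: "demotion R J I"
  shows "demotion S (ideal_ext S h J) (ideal_ext S h I)"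
proof -
  have I: "ideal I R" and J: "ideal J R" and "J \<subseteq> I"
    and eq: "\<And>r s. ideal_prod R (ideal_pow R I r) (ideal_pow R J s)
               = ideal_pow R I (r + s) \<inter> ideal_pow R J s"
    using dem by (auto simp: demotion_def)
  have "ideal_prod S (ideal_pow S (ideal_ext S h I) r) (ideal_pow S (ideal_ext S h J) s)
      = ideal_pow S (ideal_ext S h I) (r + s) \<inter> ideal_pow S (ideal_ext S h J) s" for r s
    using flat_ideal_ext_Int[OF flat R.ideal_pow_is_ideal[OF I] R.ideal_pow_is_ideal[OF J],
        of "r + s" s]
      ideal_ext_prod[OF R.ideal_pow_is_ideal[OF I] R.ideal_pow_is_ideal[OF J], of r s]
    by (simp add: eq ideal_ext_pow I J)
  then show ?thesis
    by (simp add: demotion_def ideal_ext_is_ideal I J ideal_ext_mono \<open>J \<subseteq> I\<close>)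
qed

lemma faithfully_flat_demotion_descends:
  assumes ff: "faithfully_flat_module R base_module"
    and I: "ideal I R" and J: "ideal J R" and "J \<subseteq> I"
    and dem: "demotion S (ideal_ext S h J) (ideal_ext S h I)"
  shows "demotion R J I"
proof -
  have "ideal_prod R (ideal_pow R I r) (ideal_pow R J s)
      = ideal_pow R I (r + s) \<inter> ideal_pow R J s" (is "?A = ?B") for r s
  proof (rule faithfully_flat_ideal_ext_inj[OF ff])
    show "ideal ?A R" and "ideal ?B R"
      by (intro R.ideal_prod_is_ideal R.i_intersect R.ideal_pow_is_ideal I J)+
    have "ideal_ext S h ?A
        = ideal_prod S (ideal_pow S (ideal_ext S h I) r) (ideal_pow S (ideal_ext S h J) s)"
      by (simp add: ideal_ext_prod ideal_ext_pow R.ideal_pow_is_ideal I J)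
    also have "\<dots> = ideal_pow S (ideal_ext S h I) (r + s) \<inter> ideal_pow S (ideal_ext S h J) s"
      using dem by (simp add: demotion_def)
    also have "\<dots> = ideal_ext S h (ideal_pow R I (r + s)) \<inter> ideal_ext S h (ideal_pow R J s)"
      by (simp add: ideal_ext_pow I J)
    finally show "ideal_ext S h ?A = ideal_ext S h ?B"
      using flat_ideal_ext_Int[OF faithfully_flat_imp_flat[OF ff] R.ideal_pow_is_ideal[OF I]
          R.ideal_pow_is_ideal[OF J]]
      by simp
  qed
  with I J \<open>J \<subseteq> I\<close> show ?thesis by (simp add: demotion_def)
qed

end

theorem proposition3p2:
  fixes R :: "('a, 'm) ring_scheme" and S :: "('b, 'n) ring_scheme"
    and f :: "'a \<Rightarrow> 'b" and I J :: "'a set"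
  assumes "cring R" and "noetherian_ring R" and "cring S"
    and "f \<in> ring_hom R S"
    and "ideal I R" and "ideal J R" and "J \<subseteq> I"
  shows "(demotion R J I \<longrightarrow> (\<forall>k\<ge>1. demotion R (ideal_pow R J k) (ideal_pow R I k))) \<and>
    (flat_module R (restrict_scalars f S) \<and> demotion R J I \<longrightarrow>
       demotion S (ideal_ext S f J) (ideal_ext S f I)) \<and>
    (faithfully_flat_module R (restrict_scalars f S) \<and>
       demotion S (ideal_ext S f J) (ideal_ext S f I) \<longrightarrow>
       demotion R J I)"
proof (intro conjI impI allI)
  interpret ring_hom_cring R S f
    by (intro ring_hom_cringI ring_hom_ringI2 assms cring.axioms(1))
  show "demotion R (ideal_pow R J k) (ideal_pow R I k)" if "demotion R J I" for k
    by (rule R.demotion_pow[OF that])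
  show "demotion S (ideal_ext S f J) (ideal_ext S f I)"
    if "flat_module R (restrict_scalars f S) \<and> demotion R J I"
    using that flat_demotion_ext by blast
  show "demotion R J I"
    if "faithfully_flat_module R (restrict_scalars f S) \<and>
       demotion S (ideal_ext S f J) (ideal_ext S f I)"
    using that faithfully_flat_demotion_descends assms(5-7) by blast
qed

end
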